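(* Every primitive Pisot substitution $\tau$, seen as a map $\tau : X_\tau \to X_\tau$ on its one-sided subshift, has balanced growth; that is, there is a real number $Z(\tau)$ such that $\lim_{n} |\tau(x_{[0,n-1]})|/n = Z(\tau)$ for all $x \in X_\tau$, and there is a constant $D \in \mathbb{N}$ such that $|\tau(x_{[0,n-1]})| \in [Z(\tau) n - D, Z(\tau) n + D]$ for all $x \in X_\tau$ and all $n \in \mathbb{N}$.
   Context: $\mathbb{N}$ contains $0$. For a finite alphabet $A$, $A^*$ is the set of finite words, $|w|$ is the length of $w$, $|w|_b$ the number of occurrences of the letter $b$ in $w$, and $v \sqsubset w$ means that $v$ is a factor (contiguous subword) of $w$; $x_{[i,j]} = x_i x_{i+1} \cdots x_j$. A substitution on $A$ is a map $\tau : A^* \to A^*$ with $\tau(uv) = \tau(u)\tau(v)$. Its associated matrix is the $|A| \times |A|$ matrix whose $(a,b)$ entry is $|\tau(a)|_b$. The one-sided subshift $X_\tau \subset A^{\mathbb{N}}$ is the set of $x \in A^{\mathbb{N}}$ all of whose factors are factors of $\tau^n(a)$ for some $a \in A$, $n \in \mathbb{N}$; $\tau$ acts on it by $\tau(x) = \tau(x_0)\tau(x_1)\cdots$. $\tau$ is primitive if for all $a, b \in A$ we have $a \sqsubset \tau^n(b)$ for all large enough $n$. $\tau$ is Pisot if the eigenvalues of its associated matrix are $\lambda_1, \ldots, \lambda_k$ with $|\lambda_1| > 1$ and $|\lambda_i| < 1$ for all $i > 1$. *)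

theory Defs
  imports "HOL-Analysis.Analysis" "HOL-Library.Sublist"
begin

text \<open>
  The finite alphabet is a type \<open>'a :: finite\<close>. Finite words are lists, one-sided infinite words
  are functions on \<open>nat\<close>, and factors are contiguous sublists (\<open>sublist\<close>).
\<close>

definition substitution :: "('a list \<Rightarrow> 'a list) \<Rightarrow> bool" where
  "substitution \<tau> \<longleftrightarrow> (\<forall>u v. \<tau> (u @ v) = \<tau> u @ \<tau> v)"

definition subst_matrix :: "('a::finite list \<Rightarrow> 'a list) \<Rightarrow> complex ^ 'a ^ 'a" where
  "subst_matrix \<tau> = (\<chi> a b. of_nat (count_list (\<tau> [a]) b))"

definition eigenvalues :: "complex ^ 'n ^ 'n \<Rightarrow> complex set" where
  "eigenvalues M = {c. \<exists>v. v \<noteq> 0 \<and> M *v v = c *s v}"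

text \<open>
  The eigenvalues are listed as a set, without multiplicities, so nothing is required about the
  multiplicity of \<open>ev 1\<close>. For a primitive substitution the dominant eigenvalue is simple by the
  Perron--Frobenius theorem, so there it makes no difference whether multiplicities are counted.
\<close>

definition pisot :: "('a::finite list \<Rightarrow> 'a list) \<Rightarrow> bool" where
  "pisot \<tau> \<longleftrightarrow>
    (\<exists>(k::nat) ev. k \<ge> 1 \<and> eigenvalues (subst_matrix \<tau>) = ev ` {1..k} \<and>
       norm (ev 1) > 1 \<and> (\<forall>i\<in>{1<..k}. norm (ev i) < 1))"

definition primitive :: "('a list \<Rightarrow> 'a list) \<Rightarrow> bool" where
  "primitive \<tau> \<longleftrightarrow> (\<forall>a b. \<forall>\<^sub>F n in sequentially. sublist [a] ((\<tau> ^^ n) [b]))"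

text \<open>\<open>segment x i j\<close> is the factor from position \<open>i\<close> to position \<open>j - 1\<close> inclusive;
  it is empty if \<open>j \<le> i\<close>.\<close>

definition segment :: "(nat \<Rightarrow> 'a) \<Rightarrow> nat \<Rightarrow> nat \<Rightarrow> 'a list" where
  "segment x i j = map x [i..<j]"

definition subst_subshift :: "('a list \<Rightarrow> 'a list) \<Rightarrow> (nat \<Rightarrow> 'a) set" where
  "subst_subshift \<tau> = {x. \<forall>i j. \<exists>a n. sublist (segment x i j) ((\<tau> ^^ n) [a])}"

definition balanced_growth :: "('a list \<Rightarrow> 'a list) \<Rightarrow> (nat \<Rightarrow> 'a) set \<Rightarrow> bool" where
  "balanced_growth \<tau> X \<longleftrightarrow>
    (\<exists>Z::real.
       (\<forall>x\<in>X. (\<lambda>n. real (length (\<tau> (segment x 0 n))) / real n) \<longlonglongrightarrow> Z) \<and>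
       (\<exists>D::nat. \<forall>x\<in>X. \<forall>n.
          real (length (\<tau> (segment x 0 n))) \<in> {Z * real n - real D .. Z * real n + real D}))"

end

theory Submission
  imports Defs "HOL-Computational_Algebra.Fundamental_Theorem_Algebra"
begin

text \<open>
  Let \<open>M\<close> be the matrix of \<open>\<tau>\<close> and \<open>\<mu>\<close> its Perron eigenvalue, with positive left eigenvector \<open>u\<close>.
  The additive functional \<open>g w = |\<tau> w| - \<mu> |w|\<close> satisfies \<open>g (\<tau>\<^sup>n a) = (M\<^sup>n h)\<^sub>a\<close>, where
  \<open>h = M 1 - \<mu> 1\<close> is orthogonal to \<open>u\<close>. The hyperplane orthogonal to \<open>u\<close> is invariant under \<open>M\<close>
  and contains no Perron eigenvector, so by the Pisot condition all eigenvalues of \<open>M\<close> on it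
  have modulus less than 1 and \<open>\<Sum>\<^sub>n |M\<^sup>n h|\<close> converges. Every prefix of \<open>\<tau>\<^sup>n a\<close> splits as
  \<open>\<tau>\<^sup>n\<^sup>-\<^sup>1(p\<^sub>n\<^sub>-\<^sub>1) \<dots> \<tau>(p\<^sub>1) p\<^sub>0\<close> with words \<open>p\<^sub>i\<close> of bounded length, so \<open>g\<close> is
  bounded on prefixes, hence on
  factors, of the words \<open>\<tau>\<^sup>n a\<close>. Therefore \<open>Z = \<mu>\<close>.
\<close>

subsection \<open>Summability of orbits of a matrix\<close>

text \<open>This is \<open>p(M) v\<close>, evaluated by Horner's scheme directly on the vector, so
  that no polynomials with matrix values enter.\<close>

definition matpoly :: "'a::field ^ 'n ^ 'n \<Rightarrow> 'a poly \<Rightarrow> 'a ^ 'n \<Rightarrow> 'a ^ 'n" where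
  "matpoly M p v = fold_coeffs (\<lambda>a w. a *s v + M *v w) p 0"

lemma matpoly_0 [simp]: "matpoly M 0 v = 0"
  by (simp add: matpoly_def)

lemma matpoly_pCons [simp]: "matpoly M (pCons a p) v = a *s v + M *v matpoly M p v"
  by (cases "p = 0 \<and> a = 0") (auto simp: matpoly_def)

lemma matpoly_add: "matpoly M (p + q) v = matpoly M p v + matpoly M q v"
  by (induction p q rule: poly_induct2) (simp_all add: vec.scale_left_distrib matrix_vector_right_distrib)

lemma matpoly_smult: "matpoly M (smult c p) v = c *s matpoly M p v"
  by (induction p) (simp_all add: vec.scale_right_distrib vector_scalar_commute)

lemma matpoly_sum: "matpoly M (\<Sum>i\<in>I. p i) v = (\<Sum>i\<in>I. matpoly M (p i) v)"
  by (induction I rule: infinite_finite_induct) (simp_all add: matpoly_add)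

lemma matpoly_monom: "matpoly M (monom c i) v = c *s ((*v) M ^^ i) v"
  by (induction i) (simp_all add: monom_0 monom_Suc vector_scalar_commute)

lemma matpoly_mult_linear:
  "matpoly M ([:- c, 1:] * p) v = M *v matpoly M p v - c *s matpoly M p v"
  by (simp add: matpoly_add matpoly_smult flip: smult_minus_left)

text \<open>\<open>M - c\<close> commutes with \<open>p(M)\<close>. Hence if
  \<open>(X - c) q\<close> annihilates \<open>v\<close>, then \<open>q\<close> annihilates
  \<open>(M - c) v\<close>, which is what the degree induction below descends to.\<close>

lemma matpoly_shift:
  "matpoly M p (M *v v - c *s v) = M *v matpoly M p v - c *s matpoly M p v"
  by (induction p)
    (simp_all add: vec.scale_right_distrib vec.scale_right_diff_distrib vector_scalar_commute
      matrix_vector_right_distrib matrix_vector_mult_diff_distrib vec.scale_left_commute)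

lemma matpoly_in_subspace:
  assumes "vec.subspace V" "\<And>v. v \<in> V \<Longrightarrow> M *v v \<in> V" "v \<in> V"
  shows "matpoly M p v \<in> V"
  using assms by (induction p) (simp_all add: vec.subspace_0 vec.subspace_add vec.subspace_scale)

text \<open>The iterates \<open>M^i v\<close> with \<open>i\<close> up to the dimension are one
  vector too many to be independent; the coefficients of a relation between them form the
  polynomial.\<close>

lemma ex_annihilating_poly:
  fixes M :: "'a::field ^ 'n ^ 'n"
  shows "\<exists>p. p \<noteq> 0 \<and> matpoly M p v = 0"
proof -
  define f where "f i = ((*v) M ^^ i) v" for i
  let ?d = "CARD('n)"
  have "\<exists>c. (\<exists>i\<le>?d. c i \<noteq> 0) \<and> (\<Sum>i\<le>?d. c i *s f i) = 0"
  \<comment> \<open>Dependence is a notion about sets, so a repetition among the \<open>f i\<close>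
    is treated apart: there the relation is \<open>f i - f j = 0\<close>.\<close>
  proof (cases "inj_on f {..?d}")
    case True
    have "vec.dependent (f ` {..?d})"
      by (rule vec.dependent_biggerset_general)
        (simp add: card_image[OF True] less_Suc_eq_le dim_subset_UNIV_cart_gen)
    then obtain u where u: "\<exists>w\<in>f ` {..?d}. u w \<noteq> 0" "(\<Sum>w\<in>f ` {..?d}. u w *s w) = 0"
      by (auto simp: vec.dependent_finite)
    then show ?thesis
      by (intro exI[of _ "u \<circ> f"]) (auto simp: sum.reindex[OF True])
  next
    case False
    then obtain i j where ij: "i \<le> ?d" "j \<le> ?d" "f i = f j" "i \<noteq> j"
      by (auto simp: inj_on_def)
    define c :: "nat \<Rightarrow> 'a" where "c k = (if k = i then 1 else 0) - (if k = j then 1 else 0)" for k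
    have "(\<Sum>k\<le>?d. c k *s f k) =
        (\<Sum>k\<le>?d. if k = i then f i else 0) - (\<Sum>k\<le>?d. if k = j then f j else 0)"
      unfolding sum_subtractf [symmetric] by (rule sum.cong) (auto simp: c_def)
    also have "\<dots> = 0"
      using ij by simp
    finally show ?thesis
      using ij by (intro exI[of _ c]) (auto simp: c_def)
  qed
  then obtain c i where c: "i \<le> ?d" "c i \<noteq> 0" "(\<Sum>i\<le>?d. c i *s f i) = 0" by auto
  define p where "p = (\<Sum>i\<le>?d. monom (c i) i)"
  have "coeff p i = c i"
    using c(1) by (simp add: p_def coeff_sum)
  moreover have "matpoly M p v = 0"
    using c(3) by (simp add: p_def matpoly_sum matpoly_monom f_def)
  ultimately show ?thesis
    using c(2) by (intro exI[of _ p]) auto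
qed

text \<open>Summing the recurrence bounds each partial sum by \<open>c\<close> times itself plus a
  constant; since \<open>c < 1\<close>, the partial sums stay bounded.\<close>

lemma summable_linear_recurrence:
  fixes a e :: "nat \<Rightarrow> real"
  assumes "\<And>n. 0 \<le> a n" "\<And>n. 0 \<le> e n" "summable e" "0 \<le> c" "c < 1"
    and rec: "\<And>n. a (Suc n) \<le> c * a n + e n"
  shows "summable a"
proof -
  have bound: "(1 - c) * sum a {..<n} \<le> a 0 + suminf e" for n
  proof (cases n)
    case 0
    then show ?thesis using assms by (simp add: suminf_nonneg)
  next
    case (Suc m)
    have "sum a {..<Suc m} = a 0 + (\<Sum>i<m. a (Suc i))"
      by (rule sum.lessThan_Suc_shift)
    also have "\<dots> \<le> a 0 + (\<Sum>i<m. c * a i + e i)"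
      using rec by (intro add_left_mono sum_mono) auto
    also have "\<dots> = a 0 + c * sum a {..<m} + sum e {..<m}"
      by (simp add: sum.distrib sum_distrib_left)
    \<comment> \<open>Lengthening the sum to \<open>Suc m\<close> makes the partial sum of the
      left-hand side appear on the right as well, where it is absorbed.\<close>
    also have "\<dots> \<le> a 0 + c * sum a {..<Suc m} + suminf e"
      using assms by (intro add_mono mult_left_mono sum_le_suminf) auto
    finally show ?thesis using Suc by (simp add: algebra_simps)
  qed
  show ?thesis
  proof (rule summableI_nonneg_bounded)
    show "sum a {..<n} \<le> (a 0 + suminf e) / (1 - c)" for n
      using bound[of n] \<open>c < 1\<close> by (simp add: field_simps)
  qed (use assms in auto)
qed

lemma norm_vector_scalar_complex: "norm (c *s v) = norm c * norm (v :: complex ^ 'n)"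
  by (simp add: norm_vec_def L2_set_right_distrib norm_mult)

text \<open>
  Induction on the degree of a polynomial \<open>p = (X - c) q\<close> with \<open>p(M) v = 0\<close>. If \<open>|c| < 1\<close>, the orbit of
  \<open>v\<close> satisfies a contracting recurrence driven by the orbit of \<open>(M - c) v\<close>, which \<open>q(M)\<close> kills;
  otherwise \<open>c\<close> is not an eigenvalue on \<open>V\<close>, so already \<open>q(M) v = 0\<close>.
\<close>

lemma summable_norm_orbit:
  fixes M :: "complex ^ 'n ^ 'n"
  assumes V: "vec.subspace V" "\<And>v. v \<in> V \<Longrightarrow> M *v v \<in> V"
    and ev: "\<And>v c. v \<in> V \<Longrightarrow> v \<noteq> 0 \<Longrightarrow> M *v v = c *s v \<Longrightarrow> norm c < 1"
    and "v \<in> V"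
  shows "summable (\<lambda>n. norm (((*v) M ^^ n) v))"
proof -
  have "summable (\<lambda>n. norm (((*v) M ^^ n) v))"
    if "p \<noteq> 0" "matpoly M p v = 0" "v \<in> V" for p v
    using that
  proof (induction "degree p" arbitrary: p v)
    case 0
    then obtain a where "p = [:a:]" by (metis degree_eq_zeroE)
    then have "v = 0" using 0 by auto
    then have "((*v) M ^^ n) v = 0" for n by (induction n) auto
    then show ?case by simp
  next
    case (Suc k)
    obtain c where "poly p c = 0"
      using fundamental_theorem_of_algebra[of p] Suc.hyps(2) by (auto simp: constant_degree)
    then obtain q where q: "p = [:- c, 1:] * q"
      by (metis poly_eq_0_iff_dvd dvdE)
    then have "q \<noteq> 0" using Suc.prems by auto
    then have k: "k = degree q"
      using Suc.hyps(2) by (simp add: q degree_mult_eq del: mult_pCons_left)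
    let ?w = "M *v v - c *s v" and ?u = "matpoly M q v"
    have zero: "M *v ?u - c *s ?u = 0"
      using Suc.prems(2) unfolding q matpoly_mult_linear .
    show ?case
    proof (cases "norm c < 1")
      case True
      have "?w \<in> V"
        using V Suc.prems by (simp add: vec.subspace_diff vec.subspace_scale)
      then have e: "summable (\<lambda>n. norm (((*v) M ^^ n) ?w))"
        using \<open>q \<noteq> 0\<close> k zero by (intro Suc.hyps(1)[of q]) (auto simp: matpoly_shift)
      have step: "((*v) M ^^ Suc n) v = c *s ((*v) M ^^ n) v + ((*v) M ^^ n) ?w" for n
        by (induction n) (simp_all add: matrix_vector_right_distrib vector_scalar_commute)
      show ?thesis
      proof (rule summable_linear_recurrence[OF _ _ e])
        show "norm (((*v) M ^^ Suc n) v) \<le> norm c * norm (((*v) M ^^ n) v) + norm (((*v) M ^^ n) ?w)" for n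
          unfolding step by (metis norm_triangle_ineq norm_vector_scalar_complex)
      qed (use True in auto)
    next
      case False
      have "?u \<in> V"
        using V Suc.prems by (intro matpoly_in_subspace)
      then have "?u = 0"
        using zero ev[of ?u c] False by auto
      then show ?thesis
        using \<open>q \<noteq> 0\<close> k Suc.prems by (intro Suc.hyps(1)[of q])
    qed
  qed
  moreover obtain p where "p \<noteq> 0" "matpoly M p v = 0"
    using ex_annihilating_poly by blast
  ultimately show ?thesis using \<open>v \<in> V\<close> by blast
qed

subsection \<open>Perron eigenvectors\<close>

text \<open>Brouwer's fixed point theorem for the normalised action on the simplex.\<close>

lemma nonneg_matrix_eigenvector:
  fixes A :: "'n::finite \<Rightarrow> 'n \<Rightarrow> real"
  assumes nonneg: "\<And>a b. 0 \<le> A a b" and row: "\<And>a. \<exists>b. 0 < A a b"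
  obtains u \<mu> where "\<And>a. 0 \<le> u a" "\<exists>a. 0 < u a" "0 < \<mu>"
    "\<And>b. (\<Sum>a\<in>UNIV. u a * A a b) = \<mu> * u b"
proof -
  define S :: "(real ^ 'n) set" where "S = {x. (\<forall>a. 0 \<le> x $ a) \<and> (\<Sum>a\<in>UNIV. x $ a) = 1}"
  define g where "g x b = (\<Sum>a\<in>UNIV. x $ a * A a b)" for x :: "real ^ 'n" and b
  \<comment> \<open>Dividing by the total mass \<open>s x\<close> brings the image of
    \<open>x\<close> back to the simplex; at the fixed point \<open>s x\<close> is the
    eigenvalue.\<close>
  define s where "s x = (\<Sum>b\<in>UNIV. g x b)" for x :: "real ^ 'n"
  have g_nonneg: "0 \<le> g x b" if "x \<in> S" for x b
    using that nonneg by (auto simp: g_def S_def intro!: sum_nonneg)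
  have s_pos: "0 < s x" if x: "x \<in> S" for x
  proof -
    have "\<exists>a. x $ a \<noteq> 0"
    proof (rule ccontr)
      assume "\<nexists>a. x $ a \<noteq> 0"
      then show False using x by (simp add: S_def)
    qed
    then obtain a where a: "0 < x $ a" using x by (force simp: S_def less_le)
    obtain b where b: "0 < A a b" using row by blast
    have "0 < g x b"
      unfolding g_def by (rule sum_pos2[of _ a]) (use a b x nonneg in \<open>auto simp: S_def\<close>)
    then show ?thesis
      unfolding s_def using g_nonneg[OF x] by (intro sum_pos2[of _ b]) auto
  qed
  have "closed S"
    unfolding S_def by (intro closed_Collect_conj closed_Collect_all closed_Collect_le closed_Collect_eq continuous_intros)
  moreover have "bounded S"
  proof (rule boundedI)
    fix x assume "x \<in> S"
    have "norm x \<le> (\<Sum>a\<in>UNIV. \<bar>x $ a\<bar>)" by (rule norm_le_l1_cart)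
    also have "\<dots> = 1" using \<open>x \<in> S\<close> by (simp add: S_def)
    finally show "norm x \<le> 1" .
  qed
  ultimately have "compact S" by (simp add: compact_eq_bounded_closed)
  moreover have "convex S"
    by (auto simp: convex_def S_def sum.distrib simp flip: sum_distrib_left)
  moreover have "S \<noteq> {}"
  proof -
    have "axis undefined 1 \<in> S" by (auto simp: S_def axis_def)
    then show ?thesis by blast
  qed
  moreover have "continuous_on S (\<lambda>x. \<chi> b. g x b / s x)"
  proof -
    have "s x \<noteq> 0" if "x \<in> S" for x using s_pos[OF that] by simp
    then show ?thesis unfolding s_def g_def
      by (intro continuous_intros) auto
  qed
  moreover have "(\<lambda>x. \<chi> b. g x b / s x) \<in> S \<rightarrow> S"
  proof
    fix x assume x: "x \<in> S"
    have "(\<Sum>b\<in>UNIV. g x b / s x) = 1"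
      using s_pos[OF x] by (simp add: s_def flip: sum_divide_distrib)
    then show "(\<chi> b. g x b / s x) \<in> S"
      using g_nonneg[OF x] s_pos[OF x] by (auto simp: S_def)
  qed
  ultimately obtain x where x: "x \<in> S" "(\<chi> b. g x b / s x) = x"
    by (rule brouwer)
  show thesis
  proof (rule that[of "\<lambda>a. x $ a" "s x"])
    show "0 \<le> x $ a" for a using x by (simp add: S_def)
    show "\<exists>a. 0 < x $ a"
    proof (rule ccontr)
      assume "\<nexists>a. 0 < x $ a"
      then have "(\<Sum>a\<in>UNIV. x $ a) \<le> 0" by (intro sum_nonpos) (simp add: not_less)
      then show False using x by (simp add: S_def)
    qed
    show "0 < s x" by (rule s_pos[OF x(1)])
    show "(\<Sum>a\<in>UNIV. x $ a * A a b) = s x * x $ b" for b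
    proof -
      have "x $ b = g x b / s x" by (subst x(2)[symmetric]) simp
      then show ?thesis using s_pos[OF x(1)] by (simp add: g_def)
    qed
  qed
qed

subsection \<open>Primitive substitutions\<close>

lemma substitution_Nil: "substitution \<tau> \<Longrightarrow> \<tau> [] = []"
  by (metis append_self_conv substitution_def)

lemma substitution_Cons: "substitution \<tau> \<Longrightarrow> \<tau> (a # w) = \<tau> [a] @ \<tau> w"
  by (metis append_Cons append_Nil substitution_def)

lemma substitution_funpow: "substitution \<tau> \<Longrightarrow> substitution (\<tau> ^^ n)"
  by (induction n) (simp_all add: substitution_def)

lemma set_substitution: "substitution \<tau> \<Longrightarrow> set (\<tau> w) = (\<Union>a\<in>set w. set (\<tau> [a]))"
proof (induction w)
  case (Cons a w)
  then show ?case using substitution_Cons[of \<tau> a w] by simp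
qed (simp add: substitution_Nil)

lemma sum_list_map_substitution:
  "substitution \<tau> \<Longrightarrow>
    sum_list (map f (\<tau> w)) = sum_list (map (\<lambda>a. sum_list (map f (\<tau> [a]))) w)"
  for f :: "'a \<Rightarrow> 'b::comm_monoid_add"
proof (induction w)
  case (Cons a w)
  then show ?case using substitution_Cons[of \<tau> a w] by simp
qed (simp add: substitution_Nil)

lemma count_list_substitution:
  "substitution \<tau> \<Longrightarrow> count_list (\<tau> w) b = (\<Sum>a\<leftarrow>w. count_list (\<tau> [a]) b)"
proof (induction w)
  case (Cons a w)
  then show ?case using substitution_Cons[of \<tau> a w] by simp
qed (simp add: substitution_Nil)

lemma sum_list_map_eq_sum_UNIV:
  fixes f :: "'a::finite \<Rightarrow> 'b::semiring_1"
  shows "sum_list (map f w) = (\<Sum>b\<in>UNIV. of_nat (count_list w b) * f b)"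
proof (induction w)
  case (Cons a w)
  have "(\<Sum>b\<in>UNIV. of_nat (count_list (a # w) b) * f b) =
      (\<Sum>b\<in>UNIV. (if a = b then f b else 0) + of_nat (count_list w b) * f b)"
    by (rule sum.cong) (auto simp: distrib_right)
  then show ?case using Cons by (simp add: sum.distrib)
qed simp

lemma subst_matrix_mult:
  "(subst_matrix \<tau> *v v) $ a = (\<Sum>b\<leftarrow>\<tau> [a]. v $ b)"
  by (simp add: subst_matrix_def matrix_vector_mult_def sum_list_map_eq_sum_UNIV)

text \<open>A vector is read as a weight on letters, and the matrix replaces the weight of
  \<open>a\<close> by that of the word \<open>\<tau> [a]\<close>. Orbits of the matrix thereby
  control sums over iterated words.\<close>

lemma subst_matrix_orbit:
  assumes "substitution \<tau>"
  shows "(((*v) (subst_matrix \<tau>) ^^ n) v) $ a = (\<Sum>b\<leftarrow>(\<tau> ^^ n) [a]. v $ b)"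
proof (induction n arbitrary: v)
  case (Suc n)
  have "(((*v) (subst_matrix \<tau>) ^^ Suc n) v) $ a =
      (\<Sum>b\<leftarrow>(\<tau> ^^ n) [a]. (subst_matrix \<tau> *v v) $ b)"
    by (simp add: funpow_swap1 Suc)
  also have "\<dots> = (\<Sum>b\<leftarrow>(\<tau> ^^ Suc n) [a]. v $ b)"
    by (simp add: subst_matrix_mult sum_list_map_substitution[OF assms, where w = "(\<tau> ^^ n) [a]"])
  finally show ?case .
qed simp

lemma right_eigenvector_funpow:
  fixes r :: "'a \<Rightarrow> real"
  assumes "substitution \<tau>" and r: "\<And>a. (\<Sum>b\<leftarrow>\<tau> [a]. r b) = \<mu> * r a"
  shows "(\<Sum>b\<leftarrow>(\<tau> ^^ n) w. r b) = \<mu> ^ n * (\<Sum>b\<leftarrow>w. r b)"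
  by (induction n)
    (simp_all add: sum_list_map_substitution[OF assms(1), where w = "(\<tau> ^^ n) w" for n] r sum_list_const_mult)

text \<open>The counts in \<open>(\<tau> ^^ n) [a]\<close> are the entries of the
  \<open>n\<close>-th power of the matrix, because the letters of the next iterate are counted
  through the letters \<open>c\<close> of the current one.\<close>

lemma left_eigenvector_funpow:
  fixes u :: "'a::finite \<Rightarrow> real"
  assumes "substitution \<tau>"
    and u: "\<And>b. (\<Sum>a\<in>UNIV. u a * count_list (\<tau> [a]) b) = \<mu> * u b"
  shows "(\<Sum>a\<in>UNIV. u a * count_list ((\<tau> ^^ n) [a]) b) = \<mu> ^ n * u b"
proof (induction n arbitrary: b)
  case 0
  have "(\<Sum>a\<in>UNIV. u a * count_list [a] b) = (\<Sum>a\<in>UNIV. if a = b then u a else 0)"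
    by (rule sum.cong) auto
  then show ?case by simp
next
  case (Suc n)
  have "(\<Sum>a\<in>UNIV. u a * count_list ((\<tau> ^^ Suc n) [a]) b) =
      (\<Sum>a\<in>UNIV. \<Sum>c\<in>UNIV. u a * count_list ((\<tau> ^^ n) [a]) c * count_list (\<tau> [c]) b)"
    by (simp add: count_list_substitution[OF assms(1), of "(\<tau> ^^ n) [a]" for a]
        sum_list_map_eq_sum_UNIV[where 'b = nat] sum_distrib_left mult.assoc)
  also have "\<dots> = (\<Sum>c\<in>UNIV. \<mu> ^ n * u c * count_list (\<tau> [c]) b)"
    by (subst sum.swap) (simp add: Suc flip: sum_distrib_right)
  also have "\<dots> = \<mu> ^ Suc n * u b"
    by (simp add: u mult.assoc flip: sum_distrib_left)
  finally show ?case .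
qed

text \<open>Finiteness of the alphabet gives one threshold for all pairs of letters. The exponent
  has the form \<open>Suc N\<close> so that one application of \<open>\<tau>\<close> can be split
  off.\<close>

lemma primitive_power_full:
  fixes \<tau> :: "'a::finite list \<Rightarrow> 'a list"
  assumes "primitive \<tau>"
  obtains N where "\<And>a b. b \<in> set ((\<tau> ^^ Suc N) [a])"
proof -
  have "\<forall>\<^sub>F n in sequentially. \<forall>a b. b \<in> set ((\<tau> ^^ n) [a])"
  proof (intro eventually_all_finite)
    fix a b
    have "\<forall>\<^sub>F n in sequentially. sublist [b] ((\<tau> ^^ n) [a])"
      using assms by (simp add: primitive_def)
    then show "\<forall>\<^sub>F n in sequentially. b \<in> set ((\<tau> ^^ n) [a])"
      by eventually_elim (auto simp: sublist_def)
  qed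
  then obtain N where "\<forall>n\<ge>N. \<forall>a b. b \<in> set ((\<tau> ^^ n) [a])"
    by (auto simp: eventually_sequentially)
  then show thesis by (intro that[of N]) (meson le_SucI order_refl)
qed

lemma sum_list_map_pos:
  fixes f :: "'a \<Rightarrow> real"
  assumes "\<And>a. 0 \<le> f a" "b \<in> set w" "0 < f b"
  shows "0 < sum_list (map f w)"
proof -
  have "f b \<le> sum_list (map f w)"
    using assms by (intro member_le_sum_list) auto
  then show ?thesis using assms by simp
qed

text \<open>The vectors come from the matrix and its transpose, with a priori different eigenvalues.
  Primitivity spreads one positive entry to all letters, and pairing the two vectors identifies the
  eigenvalues.\<close>

lemma primitive_perron_eigenvectors:
  fixes \<tau> :: "'a::finite list \<Rightarrow> 'a list"
  assumes subst: "substitution \<tau>" and prim: "primitive \<tau>"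
  obtains u r :: "'a \<Rightarrow> real" and \<mu> where
    "\<And>a. 0 < u a" "\<And>a. 0 < r a" "0 < \<mu>"
    "\<And>b. (\<Sum>a\<in>UNIV. u a * count_list (\<tau> [a]) b) = \<mu> * u b"
    "\<And>a. (\<Sum>b\<leftarrow>\<tau> [a]. r b) = \<mu> * r a"
proof -
  obtain N where N: "b \<in> set ((\<tau> ^^ Suc N) [a])" for a b
    using primitive_power_full[OF prim] by blast
  \<comment> \<open>An empty \<open>\<tau> [a]\<close> would make all later iterates of
    \<open>[a]\<close> empty.\<close>
  have nz_row: "\<exists>b. 0 < real (count_list (\<tau> [a]) b)" for a
  proof -
    have "\<tau> [a] \<noteq> []"
      using N[of a a] substitution_Nil[OF substitution_funpow[OF subst, of N]]
      by (auto simp: funpow_swap1)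
    then obtain b where "b \<in> set (\<tau> [a])" using hd_in_set by blast
    then show ?thesis by (auto simp: count_list_0_iff intro!: exI[of _ b] gr0I)
  qed
  obtain u :: "'a \<Rightarrow> real" and \<mu> where u: "\<And>a. 0 \<le> u a" "\<exists>a. 0 < u a" "0 < \<mu>"
    "\<And>b. (\<Sum>a\<in>UNIV. u a * count_list (\<tau> [a]) b) = \<mu> * u b"
    by (rule nonneg_matrix_eigenvector[where A = "\<lambda>a b. real (count_list (\<tau> [a]) b)", OF of_nat_0_le_iff nz_row]) (rule that)
  have nz_col: "\<exists>a. 0 < real (count_list (\<tau> [a]) b)" for b
  proof -
    have "b \<in> set (\<tau> ((\<tau> ^^ N) [b]))" using N[of b b] by simp
    then obtain a where "b \<in> set (\<tau> [a])"
      using set_substitution[OF subst] by blast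
    then show ?thesis by (auto simp: count_list_0_iff intro!: exI[of _ a] gr0I)
  qed
  obtain r :: "'a \<Rightarrow> real" and \<nu> where r: "\<And>a. 0 \<le> r a" "\<exists>a. 0 < r a" "0 < \<nu>"
    "\<And>a. (\<Sum>b\<in>UNIV. r b * count_list (\<tau> [a]) b) = \<nu> * r a"
    by (rule nonneg_matrix_eigenvector[where A = "\<lambda>b a. real (count_list (\<tau> [a]) b)", OF of_nat_0_le_iff nz_col]) (rule that)
  have r': "(\<Sum>b\<leftarrow>\<tau> [a]. r b) = \<nu> * r a" for a
    using r(4)[of a] by (simp add: sum_list_map_eq_sum_UNIV mult.commute)
  have u_pos: "0 < u b" for b
  proof -
    obtain a where a: "0 < u a" using u by blast
    have "0 < real (count_list ((\<tau> ^^ Suc N) [a]) b)"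
      using N[of b a] by (auto simp: count_list_0_iff intro!: gr0I simp del: funpow.simps)
    then have "0 < (\<Sum>a\<in>UNIV. u a * count_list ((\<tau> ^^ Suc N) [a]) b)"
      using a u(1) by (intro sum_pos2[of _ a]) auto
    then show ?thesis
      unfolding left_eigenvector_funpow[OF subst u(4)] using u(3) zero_less_mult_pos zero_less_power by blast
  qed
  have r_pos: "0 < r a" for a
  proof -
    obtain b where b: "0 < r b" using r by blast
    have "0 < (\<Sum>b\<leftarrow>(\<tau> ^^ Suc N) [a]. r b)"
      using r(1) N b by (rule sum_list_map_pos)
    then have "0 < \<nu> ^ Suc N * r a"
      unfolding right_eigenvector_funpow[OF subst r'] by simp
    then show ?thesis
      using r(3) zero_less_mult_pos zero_less_power by blast
  qed
  \<comment> \<open>The matrix paired with \<open>u\<close> on the left and \<open>r\<close> on the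
    right is evaluated in both orders; the positive pairing of \<open>u\<close> and \<open>r\<close>
    then cancels.\<close>
  have "\<mu> * (\<Sum>b\<in>UNIV. u b * r b) = (\<Sum>b\<in>UNIV. (\<Sum>a\<in>UNIV. u a * count_list (\<tau> [a]) b) * r b)"
    unfolding u(4) by (simp add: sum_distrib_left mult.assoc)
  also have "\<dots> = (\<Sum>b\<in>UNIV. \<Sum>a\<in>UNIV. u a * (r b * count_list (\<tau> [a]) b))"
    by (simp add: sum_distrib_left mult_ac)
  also have "\<dots> = (\<Sum>a\<in>UNIV. u a * (\<Sum>b\<in>UNIV. r b * count_list (\<tau> [a]) b))"
    by (subst sum.swap) (simp add: sum_distrib_left)
  also have "\<dots> = \<nu> * (\<Sum>b\<in>UNIV. u b * r b)"
    unfolding r(4) by (simp add: sum_distrib_left mult_ac)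
  finally have "\<mu> * (\<Sum>b\<in>UNIV. u b * r b) = \<nu> * (\<Sum>b\<in>UNIV. u b * r b)" .
  moreover have "0 < (\<Sum>b\<in>UNIV. u b * r b)"
    using u_pos r_pos by (intro sum_pos) auto
  ultimately have "\<nu> = \<mu>" by simp
  then show thesis
    using that[of u r \<mu>] u_pos r_pos u r' by simp
qed

text \<open>This will exclude the Perron eigenvalue from the hyperplane orthogonal to the left
  eigenvector: a multiple of a positive vector is orthogonal to a positive vector only if it is
  zero.\<close>

lemma perron_eigenvector_unique:
  fixes \<tau> :: "'a::finite list \<Rightarrow> 'a list" and y :: "'a \<Rightarrow> real"
  assumes subst: "substitution \<tau>" and prim: "primitive \<tau>"
    and r: "\<And>a. 0 < r a" "\<And>a. (\<Sum>b\<leftarrow>\<tau> [a]. r b) = \<mu> * r a"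
    and y: "\<And>a. (\<Sum>b\<leftarrow>\<tau> [a]. y b) = \<mu> * y a"
  shows "\<exists>t. \<forall>a. y a = t * r a"
proof -
  obtain N where N: "b \<in> set ((\<tau> ^^ Suc N) [a])" for a b
    using primitive_power_full[OF prim] by blast
  \<comment> \<open>For this \<open>t\<close>, \<open>y - t r\<close> is a nonnegative eigenvector with a zero entry, hence zero.\<close>
  define t where "t = Min (range (\<lambda>a. y a / r a))"
  define z where "z a = y a - t * r a" for a
  have "t \<in> range (\<lambda>a. y a / r a)"
    unfolding t_def by (rule Min_in) auto
  then obtain a where "t = y a / r a" by blast
  then have a: "z a = 0" using r(1)[of a] by (simp add: z_def)
  have z_nonneg: "0 \<le> z b" for b
  proof -
    have "t \<le> y b / r b" unfolding t_def by (rule Min_le) auto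
    then show ?thesis using r(1)[of b] by (simp add: z_def pos_le_divide_eq)
  qed
  have "(\<Sum>b\<leftarrow>\<tau> [a]. z b) = \<mu> * z a" for a
    by (simp add: z_def sum_list_subtractf sum_list_const_mult r y algebra_simps)
  from right_eigenvector_funpow[OF subst this]
  have "(\<Sum>b\<leftarrow>(\<tau> ^^ Suc N) [a]. z b) = 0" by (simp add: a del: funpow.simps)
  then have "z b = 0" for b
    using sum_list_map_pos[of z b "(\<tau> ^^ Suc N) [a]"] z_nonneg N[of b a]
    by (metis less_irrefl less_le)
  then show ?thesis by (auto simp: z_def)
qed

subsection \<open>Additive functionals on factors\<close>

text \<open>The cut falls in the image of one letter \<open>b\<close>, and \<open>q\<close> collects
  the letters passed before it. A cut at the very end is a case of its own, since no next letter
  need exist there.\<close>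

lemma prefix_substitutionE:
  assumes "substitution \<sigma>" "prefix p (\<sigma> w)"
  obtains "p = \<sigma> w"
  | q b p' where "prefix (q @ [b]) w" "p = \<sigma> q @ p'" "prefix p' (\<sigma> [b])"
proof -
  have "p = \<sigma> w \<or> (\<exists>q b p'. prefix (q @ [b]) w \<and> p = \<sigma> q @ p' \<and> prefix p' (\<sigma> [b]))"
    using assms(2)
  proof (induction w rule: rev_induct)
    case Nil
    then show ?case using substitution_Nil[OF assms(1)] by simp
  next
    case (snoc x w)
    have "\<sigma> (w @ [x]) = \<sigma> w @ \<sigma> [x]"
      using assms(1) by (simp add: substitution_def)
    with snoc.prems consider "prefix p (\<sigma> w)" | p' where "p = \<sigma> w @ p'" "prefix p' (\<sigma> [x])"
      by (auto simp: prefix_append)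
    then show ?case
    proof cases
      case 1
      from snoc.IH[OF this] show ?thesis
      proof
        assume "p = \<sigma> w"
        then show ?thesis
          \<comment> \<open>The end of \<open>\<sigma> w\<close> is now the start of the image of
            \<open>x\<close>, so the remainder is empty.\<close>
          by (intro disjI2 exI[of _ w] exI[of _ x] exI[of _ "[]"]) simp
      next
        assume "\<exists>q b p'. prefix (q @ [b]) w \<and> p = \<sigma> q @ p' \<and> prefix p' (\<sigma> [b])"
        then show ?thesis using prefix_prefix by blast
      qed
    next
      case 2
      then show ?thesis by blast
    qed
  qed
  then show thesis using that by blast
qed

text \<open>Induction on \<open>n\<close> peels off the outermost level: a proper prefix becomes
  \<open>(\<tau> ^^ n) q\<close> followed by a prefix of some \<open>(\<tau> ^^ n) [b]\<close>. The
  first piece costs at most a constant times \<open>e n\<close>, and summability makes the total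
  uniform in \<open>n\<close>.\<close>

lemma additive_bounded_on_prefixes:
  fixes \<tau> :: "'a::finite list \<Rightarrow> 'a list" and g :: "'a list \<Rightarrow> real"
  assumes subst: "substitution \<tau>"
    and add: "\<And>v w. g (v @ w) = g v + g w"
    and e: "summable e" "\<And>n a. \<bar>g ((\<tau> ^^ n) [a])\<bar> \<le> e n"
  obtains B where "\<And>n a p. prefix p ((\<tau> ^^ n) [a]) \<Longrightarrow> \<bar>g p\<bar> \<le> B"
proof -
  \<comment> \<open>The summand 1 lets \<open>L\<close> also bound the length of a single letter, as
    the base case requires.\<close>
  define L where "L = 1 + (\<Sum>a\<in>UNIV. length (\<tau> [a]))"
  have L: "length (\<tau> [a]) \<le> L" for a
    unfolding L_def by (rule trans_le_add2, rule member_le_sum) auto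
  have e_nonneg: "0 \<le> e n" for n
    using e(2)[of n undefined] by linarith
  have g_Nil: "g [] = 0" using add[of "[]" "[]"] by simp
  have g_pow: "\<bar>g ((\<tau> ^^ n) w)\<bar> \<le> length w * e n" for n w
  proof (induction w)
    case Nil
    then show ?case by (simp add: g_Nil substitution_Nil[OF substitution_funpow[OF subst]])
  next
    case (Cons a w)
    have "g ((\<tau> ^^ n) (a # w)) = g ((\<tau> ^^ n) [a]) + g ((\<tau> ^^ n) w)"
      by (subst substitution_Cons[OF substitution_funpow[OF subst]]) (rule add)
    then show ?case using Cons e(2)[of n a] by (simp add: distrib_right)
  qed
  have g_pow_L: "\<bar>g ((\<tau> ^^ n) w)\<bar> \<le> L * e n" if "length w \<le> L" for n w
    using g_pow[of n w] mult_right_mono[OF _ e_nonneg, of "length w" L n] that by simp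
  \<comment> \<open>The term \<open>e 0\<close> pays for the word left at level 0, the sum for the
    pieces split off at the levels above.\<close>
  have bound: "\<bar>g p\<bar> \<le> L * (e 0 + sum e {..<n})" if "prefix p ((\<tau> ^^ n) [a])" for n a p
    using that
  proof (induction n arbitrary: a p)
    case 0
    then have "length p \<le> L" by (auto simp: L_def prefix_Cons)
    then show ?case using g_pow_L[of p 0] by simp
  next
    case (Suc n)
    have "prefix p ((\<tau> ^^ n) (\<tau> [a]))"
      using Suc.prems by (simp add: funpow_swap1)
    with substitution_funpow[OF subst] show ?case
    proof (cases rule: prefix_substitutionE)
      case 1
      then have "\<bar>g p\<bar> \<le> L * e n" using g_pow_L L by simp
      also have "\<dots> \<le> L * (e 0 + sum e {..<Suc n})"
        using e_nonneg by (intro mult_left_mono) (simp_all add: sum_nonneg)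
      finally show ?thesis .
    next
      case (2 q b p')
      have "length q \<le> L"
        using prefix_length_le[OF 2(1)] L[of a] by simp
      from g_pow_L[OF this, of n] Suc.IH[OF 2(3)] show ?thesis
        by (simp add: 2(2) add distrib_left)
    qed
  qed
  have "\<bar>g p\<bar> \<le> L * (e 0 + suminf e)" if "prefix p ((\<tau> ^^ n) [a])" for n a p
  proof -
    have "L * (e 0 + sum e {..<n}) \<le> L * (e 0 + suminf e)"
      using e_nonneg e(1) by (intro mult_left_mono add_left_mono sum_le_suminf) auto
    then show ?thesis using bound[OF that] by simp
  qed
  then show thesis by (rule that)
qed

text \<open>A factor is what remains of one prefix after removing a shorter one, so additivity
  doubles the bound for prefixes.\<close>

lemma additive_bounded_on_factors:
  fixes \<tau> :: "'a::finite list \<Rightarrow> 'a list" and g :: "'a list \<Rightarrow> real"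
  assumes "substitution \<tau>"
    and add: "\<And>v w. g (v @ w) = g v + g w"
    and "summable e" "\<And>n a. \<bar>g ((\<tau> ^^ n) [a])\<bar> \<le> e n"
  obtains B where "\<And>n a w. sublist w ((\<tau> ^^ n) [a]) \<Longrightarrow> \<bar>g w\<bar> \<le> B"
proof -
  obtain B where B: "\<bar>g p\<bar> \<le> B" if "prefix p ((\<tau> ^^ n) [a])" for n a p
    using additive_bounded_on_prefixes[OF assms] by blast
  show thesis
  proof (rule that[of "2 * B"])
    fix n a w
    assume "sublist w ((\<tau> ^^ n) [a])"
    then obtain p s where "(\<tau> ^^ n) [a] = p @ w @ s" by (auto simp: sublist_def)
    then have "prefix p ((\<tau> ^^ n) [a])" "prefix (p @ w) ((\<tau> ^^ n) [a])" by simp_all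
    from this[THEN B] show "\<bar>g w\<bar> \<le> 2 * B" by (simp add: add)
  qed
qed


subsection \<open>Balanced growth\<close>

theorem lemma15:
  fixes \<tau> :: "'a::finite list \<Rightarrow> 'a list"
  assumes "substitution \<tau>" and "primitive \<tau>" and "pisot \<tau>"
  shows "balanced_growth \<tau> (subst_subshift \<tau>)"
proof -
  note subst = assms(1) and prim = assms(2)
  let ?M = "subst_matrix \<tau>"
  obtain u r :: "'a \<Rightarrow> real" and \<mu> where
    u_pos: "\<And>a. 0 < u a" and r_pos: "\<And>a. 0 < r a" and \<mu>_pos: "0 < \<mu>" and
    u: "\<And>b. (\<Sum>a\<in>UNIV. u a * count_list (\<tau> [a]) b) = \<mu> * u b" and
    r: "\<And>a. (\<Sum>b\<leftarrow>\<tau> [a]. r b) = \<mu> * r a"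
    using primitive_perron_eigenvectors[OF subst prim] by blast
  \<comment> \<open>The left eigenvector equation tested against \<open>v\<close>. The value type is
    left general because real norms and complex vectors are both inserted.\<close>
  have u_pairing: "(\<Sum>a\<in>UNIV. of_real (u a) * (\<Sum>b\<leftarrow>\<tau> [a]. v b)) =
      of_real \<mu> * (\<Sum>a\<in>UNIV. of_real (u a) * v a)"
    for v :: "'a \<Rightarrow> 'b::{real_algebra_1, comm_ring_1}"
  proof -
    have "(\<Sum>a\<in>UNIV. of_real (u a) * (\<Sum>b\<leftarrow>\<tau> [a]. v b)) =
        (\<Sum>b\<in>UNIV. of_real (\<Sum>a\<in>UNIV. u a * count_list (\<tau> [a]) b) * v b)"
      by (simp add: sum_list_map_eq_sum_UNIV sum_distrib_left sum_distrib_right mult_ac)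
        (rule sum.swap)
    then show ?thesis
      unfolding u by (simp add: sum_distrib_left mult.assoc)
  qed

  obtain k ev where k: "k \<ge> (1::nat)" "eigenvalues ?M = ev ` {1..k}"
    and ev: "norm (ev 1) > 1" "\<And>i. i \<in> {1<..k} \<Longrightarrow> norm (ev i) < 1"
    using assms(3) by (auto simp: pisot_def)
  have dichotomy: "norm c < 1 \<or> c = ev 1" if c: "c \<in> eigenvalues ?M" for c
  proof -
    obtain i where i: "i \<in> {1..k}" "c = ev i" using c unfolding k(2) by blast
    then show ?thesis using ev(2)[of i] by (cases "i = 1") auto
  qed

  \<comment> \<open>Pairing the absolute values of an eigenvector with \<open>u\<close> and using
    the triangle inequality shows this. It makes \<open>\<mu>\<close> larger than 1, so among the
    eigenvalues \<open>\<mu>\<close> can only be \<open>ev 1\<close>.\<close>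
  have "norm (ev 1) \<le> \<mu>"
  proof -
    have "ev 1 \<in> eigenvalues ?M"
      unfolding k(2) using k(1) by auto
    then obtain v where v: "v \<noteq> 0" "?M *v v = ev 1 *s v"
      by (auto simp: eigenvalues_def)
    let ?s = "\<Sum>a\<in>UNIV. u a * norm (v $ a)"
    obtain a where "v $ a \<noteq> 0" using v(1) by (auto simp: vec_eq_iff)
    then have "0 < ?s"
      using u_pos by (intro sum_pos2[of _ a]) (auto simp: less_imp_le)
    have "norm (ev 1) * ?s = (\<Sum>a\<in>UNIV. u a * norm (\<Sum>b\<leftarrow>\<tau> [a]. v $ b))"
      by (simp add: v(2) norm_mult sum_distrib_left mult_ac flip: subst_matrix_mult)
    also have "\<dots> \<le> (\<Sum>a\<in>UNIV. u a * (\<Sum>b\<leftarrow>\<tau> [a]. norm (v $ b)))"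
      using u_pos
      by (intro sum_mono mult_left_mono) (auto simp: less_imp_le sum_list_map_eq_sum_UNIV norm_mult intro!: order_trans[OF norm_sum])
    also have "\<dots> = \<mu> * ?s"
      using u_pairing[of "\<lambda>a. norm (v $ a)"] by simp
    finally show ?thesis using \<open>0 < ?s\<close> by simp
  qed
  moreover have "of_real \<mu> \<in> eigenvalues ?M"
  proof -
    have "?M *v (\<chi> a. of_real (r a)) = of_real \<mu> *s (\<chi> a. of_real (r a))"
    proof (simp add: vec_eq_iff subst_matrix_mult, intro allI)
      fix a
      have "(\<Sum>b\<leftarrow>\<tau> [a]. complex_of_real (r b)) = of_real (\<Sum>b\<leftarrow>\<tau> [a]. r b)"
        by (simp add: sum_list_map_eq_sum_UNIV)
      then show "(\<Sum>b\<leftarrow>\<tau> [a]. complex_of_real (r b)) = of_real \<mu> * of_real (r a)"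
        by (simp add: r)
    qed
    moreover have "(\<chi> a. complex_of_real (r a)) \<noteq> 0"
      using r_pos[THEN less_imp_neq] by (simp add: vec_eq_iff)
    ultimately show ?thesis by (auto simp: eigenvalues_def)
  qed
  ultimately have \<mu>: "ev 1 = of_real \<mu>"
    using dichotomy[of "of_real \<mu>"] ev(1) \<mu>_pos by auto

  define V where "V = {v :: complex ^ 'a. (\<Sum>a\<in>UNIV. of_real (u a) * v $ a) = 0}"
  have "vec.subspace V"
    by (auto simp: V_def vec.subspace_def distrib_left sum.distrib mult.left_commute simp flip: sum_distrib_left)
  moreover have "?M *v v \<in> V" if "v \<in> V" for v
    using that u_pairing[of "\<lambda>a. v $ a"] by (simp add: V_def subst_matrix_mult)
  moreover have "norm c < 1" if v: "v \<in> V" "v \<noteq> 0" "?M *v v = c *s v" for v c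
  \<comment> \<open>Otherwise \<open>c\<close> is \<open>\<mu>\<close>, and the real and imaginary
    parts of \<open>v\<close> are real solutions of the eigenvector equation, hence multiples of
    \<open>r\<close>; orthogonality to \<open>u\<close> makes both vanish.\<close>
  proof (rule ccontr)
    assume "\<not> norm c < 1"
    then have c: "c = of_real \<mu>"
      using v dichotomy[of c] \<mu> by (auto simp: eigenvalues_def)
    have eq: "(\<Sum>b\<leftarrow>\<tau> [a]. v $ b) = of_real \<mu> * v $ a" for a
      by (simp add: v(3) c flip: subst_matrix_mult)
    have pairing_v: "(\<Sum>a\<in>UNIV. of_real (u a) * v $ a) = 0"
      using v(1) by (simp add: V_def)
    have zero: "y a = 0"
      if y: "\<And>a. (\<Sum>b\<leftarrow>\<tau> [a]. y b) = \<mu> * y a" "(\<Sum>a\<in>UNIV. u a * y a) = 0" for y :: "'a \<Rightarrow> real" and a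
    proof -
      obtain t where t: "\<forall>a. y a = t * r a"
        using perron_eigenvector_unique[OF subst prim r_pos r y(1)] by blast
      then have "t * (\<Sum>a\<in>UNIV. u a * r a) = 0"
        using y(2) by (simp add: sum_distrib_left mult_ac)
      moreover have "0 < (\<Sum>a\<in>UNIV. u a * r a)"
        using u_pos r_pos by (intro sum_pos) auto
      ultimately show ?thesis using t by simp
    qed
    have "Re (v $ a) = 0" for a
    proof (rule zero)
      show "(\<Sum>b\<leftarrow>\<tau> [a]. Re (v $ b)) = \<mu> * Re (v $ a)" for a
        using arg_cong[OF eq[of a], of Re] by (simp add: sum_list_map_eq_sum_UNIV)
      show "(\<Sum>a\<in>UNIV. u a * Re (v $ a)) = 0"
        using arg_cong[OF pairing_v, of Re] by simp
    qed
    moreover have "Im (v $ a) = 0" for a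
    proof (rule zero)
      show "(\<Sum>b\<leftarrow>\<tau> [a]. Im (v $ b)) = \<mu> * Im (v $ a)" for a
        using arg_cong[OF eq[of a], of Im] by (simp add: sum_list_map_eq_sum_UNIV)
      show "(\<Sum>a\<in>UNIV. u a * Im (v $ a)) = 0"
        using arg_cong[OF pairing_v, of Im] by simp
    qed
    ultimately show False using v(2) by (simp add: vec_eq_iff complex_eq_iff)
  qed
  moreover define h :: "complex ^ 'a" where "h = (\<chi> a. of_real (length (\<tau> [a]) - \<mu>))"
  \<comment> \<open>Testing the left eigenvector equation against the constant 1 shows that the
    \<open>u\<close>-average of the image lengths is \<open>\<mu>\<close>.\<close>
  moreover have "h \<in> V"
    using u_pairing[of "\<lambda>_. 1 :: complex"]
    by (simp add: V_def h_def right_diff_distrib sum_subtractf sum_list_triv mult.commute flip: sum_distrib_left sum_distrib_right)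
  ultimately have e: "summable (\<lambda>n. norm (((*v) ?M ^^ n) h))"
    by (intro summable_norm_orbit)

  define g where "g w = length (\<tau> w) - \<mu> * length w" for w
  have g_sum: "complex_of_real (g w) = (\<Sum>b\<leftarrow>w. h $ b)" for w
  proof (induction w)
    case (Cons a w)
    then show ?case using substitution_Cons[OF subst, of a w] by (simp add: g_def h_def algebra_simps)
  qed (simp add: g_def substitution_Nil[OF subst])
  have g_add: "g (v @ w) = g v + g w" for v w
    using subst by (simp add: g_def substitution_def algebra_simps)
  have "\<bar>g ((\<tau> ^^ n) [a])\<bar> \<le> norm (((*v) ?M ^^ n) h)" for n a
  proof -
    have "\<bar>g ((\<tau> ^^ n) [a])\<bar> = norm ((((*v) ?M ^^ n) h) $ a)"
      by (simp add: subst_matrix_orbit[OF subst] flip: g_sum)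
    then show ?thesis by (simp add: Finite_Cartesian_Product.norm_nth_le)
  qed
  from additive_bounded_on_factors[OF subst g_add e this]
  obtain B where B: "\<And>n a w. sublist w ((\<tau> ^^ n) [a]) \<Longrightarrow> \<bar>g w\<bar> \<le> B" by blast
  define D where "D = nat \<lceil>B\<rceil>"
  have D: "\<bar>real (length (\<tau> (segment x 0 n))) - \<mu> * n\<bar> \<le> D"
    if "x \<in> subst_subshift \<tau>" for x n
  proof -
    have "\<bar>g (segment x 0 n)\<bar> \<le> B"
      using that B unfolding subst_subshift_def by blast
    also have "B \<le> D" unfolding D_def by linarith
    finally show ?thesis by (simp add: g_def segment_def)
  qed
  show ?thesis
    unfolding balanced_growth_def
  proof (intro exI[of _ \<mu>] conjI ballI exI[of _ D] allI)
    fix x assume x: "x \<in> subst_subshift \<tau>"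
    show "(\<lambda>n. real (length (\<tau> (segment x 0 n))) / real n) \<longlonglongrightarrow> \<mu>"
    proof (rule LIM_zero_cancel, rule Lim_null_comparison)
      \<comment> \<open>The case \<open>n = 0\<close> is excluded: with division by zero giving 0,
        the estimate would there claim \<open>\<mu> \<le> 0\<close>.\<close>
      show "\<forall>\<^sub>F n in sequentially.
          norm (length (\<tau> (segment x 0 n)) / n - \<mu>) \<le> D * inverse (real n)"
        using eventually_gt_at_top[of 0]
      proof eventually_elim
        case (elim n)
        then have "length (\<tau> (segment x 0 n)) / n - \<mu> = (length (\<tau> (segment x 0 n)) - \<mu> * n) / n"
          by (simp add: diff_divide_distrib)
        then show ?case
          using D[OF x, of n] elim by (simp add: divide_inverse abs_mult mult_right_mono)
      qed
      show "(\<lambda>n. D * inverse (real n)) \<longlonglongrightarrow> 0"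
        by (rule tendsto_mult_right_zero[OF lim_inverse_n])
    qed
    show "real (length (\<tau> (segment x 0 n))) \<in> {\<mu> * real n - real D..\<mu> * real n + real D}" for n
      using D[OF x, of n] by (auto simp: abs_le_iff)
  qed
qed

end
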